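(* Let $\epsilon,\gamma>0$ and $\delta<\frac12$. Consider any algorithm for risk-averse budgeted set cover in the black-box setting that, on every input, draws a bounded number of samples and with failure probability at most $\delta$ returns an $(\epsilon,\gamma)$-optimal solution. Then: (a) the algorithm must violate the probability threshold on some input; (b) if the probability threshold is violated by at most an additive $\kappa$ (i.e. the returned solution has second-stage cost exceeding $B$ with probability at most $\rho+\kappa$), the algorithm requires $\Omega(\frac1\kappa)$ samples; (c) if the probability threshold is violated by at most a multiplicative $(1+\kappa)$ factor (probability at most $\rho(1+\kappa)$), the algorithm requires $\Omega(\frac1{\kappa\rho})$ samples.
   Context: Risk-averse budgeted set cover: a universe $U$ of elements and a collection $\mathcal S$ of $m$ subsets of $U$; a probability distribution $\{p_A\}$ over scenarios $A\subseteq U$; first-stage costs $w^{\mathrm{I}}_S\ge0$ and scenario costs $w^A_S\ge0$; a budget $B$ and threshold $\rho\in[0,1]$. A solution chooses first-stage sets $x$ and second-stage sets $y_A$ for each scenario $A$ such that $x$ together with $y_A$ covers $A$ (the fractional version allows $x,y_A\in[0,1]^m$ with fractional covering constraints); its cost is $w^{\mathrm{I}}\cdot x+\sum_Ap_Aw^A\cdot y_A$, and the problem requires $\Pr_A[w^A\cdot y_A>B]\le\rho$, with $\mathrm{OPT}$ the optimal cost. A solution is $(\epsilon,\gamma)$-optimal if its cost is at most $(1+\epsilon)\mathrm{OPT}+\gamma$. Black-box setting: the distribution is accessible only via independent samples; scenario costs are revealed when sampled. The lower bounds hold even for the fractional version. *)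

theory Defs
  imports "HOL-Probability.Probability"
begin

text \<open>
  The part of an input that an algorithm sees: everything except the scenario distribution and
  the scenario costs.  The field \<open>cost_bound\<close> is some upper bound on the scenario costs.  Every
  input has one, and announcing it only makes algorithms more powerful; if no bound were announced,
  no algorithm drawing a bounded number of samples could be near-optimal on all inputs (an unseen
  scenario of tiny probability might be arbitrarily expensive), and lower bounds would hold vacuously.
\<close>

record 'e sc_data =
  universe :: "'e set"
  family :: "'e set set"
  first_cost :: "'e set \<Rightarrow> real"
  budget :: real
  threshold :: real
  cost_bound :: real

definition valid_data :: "'e sc_data \<Rightarrow> bool" where
  "valid_data I \<longleftrightarrow>
     finite (universe I) \<and> family I \<subseteq> Pow (universe I) \<and> \<Union> (family I) = universe I \<and>
     (\<forall>S\<in>family I. 0 \<le> first_cost I S) \<and>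
     0 \<le> budget I \<and> 0 \<le> threshold I \<and> threshold I \<le> 1"

type_synonym 'e cost_vector = "'e set \<Rightarrow> real"

text \<open>\<open>P\<close> is the scenario distribution, \<open>w A S\<close> the cost of the set \<open>S\<close> in scenario \<open>A\<close>.\<close>

definition valid_input :: "'e sc_data \<Rightarrow> 'e set pmf \<Rightarrow> ('e set \<Rightarrow> 'e cost_vector) \<Rightarrow> bool" where
  "valid_input I P w \<longleftrightarrow>
     valid_data I \<and> set_pmf P \<subseteq> Pow (universe I) \<and>
     (\<forall>A\<subseteq>universe I. \<forall>S\<in>family I. 0 \<le> w A S \<and> w A S \<le> cost_bound I)"

text \<open>
  A solution is a pair \<open>(x, y)\<close> of first-stage decisions \<open>x S\<close> and second-stage decisions \<open>y A S\<close>.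
  All decisions lie in \<open>X\<close>, which is \<open>{0, 1}\<close> for the integral and \<open>{0..1}\<close> for the fractional
  problem.
\<close>

type_synonym 'e solution = "('e set \<Rightarrow> real) \<times> ('e set \<Rightarrow> 'e set \<Rightarrow> real)"

definition is_solution :: "real set \<Rightarrow> 'e sc_data \<Rightarrow> 'e solution \<Rightarrow> bool" where
  "is_solution X I = (\<lambda>(x, y).
     (\<forall>S\<in>family I. x S \<in> X) \<and>
     (\<forall>A\<subseteq>universe I.
        (\<forall>S\<in>family I. y A S \<in> X) \<and>
        (\<forall>e\<in>A. (\<Sum>S\<in>{S \<in> family I. e \<in> S}. x S + y A S) \<ge> 1)))"

definition second_stage_cost ::
    "'e sc_data \<Rightarrow> ('e set \<Rightarrow> 'e cost_vector) \<Rightarrow> 'e solution \<Rightarrow> 'e set \<Rightarrow> real" where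
  "second_stage_cost I w s A = (\<Sum>S\<in>family I. w A S * snd s A S)"

definition total_cost ::
    "'e sc_data \<Rightarrow> 'e set pmf \<Rightarrow> ('e set \<Rightarrow> 'e cost_vector) \<Rightarrow> 'e solution \<Rightarrow> real" where
  "total_cost I P w s =
     (\<Sum>S\<in>family I. first_cost I S * fst s S) +
     measure_pmf.expectation P (second_stage_cost I w s)"

definition exceed_prob ::
    "'e sc_data \<Rightarrow> 'e set pmf \<Rightarrow> ('e set \<Rightarrow> 'e cost_vector) \<Rightarrow> 'e solution \<Rightarrow> real" where
  "exceed_prob I P w s = measure_pmf.prob P {A. second_stage_cost I w s A > budget I}"

definition OPT ::
    "real set \<Rightarrow> 'e sc_data \<Rightarrow> 'e set pmf \<Rightarrow> ('e set \<Rightarrow> 'e cost_vector) \<Rightarrow> real" where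
  "OPT X I P w =
     Inf {total_cost I P w s | s. is_solution X I s \<and> exceed_prob I P w s \<le> threshold I}"

text \<open>Near-optimality does not include the probability constraint, which may be violated.\<close>

definition near_optimal ::
    "real set \<Rightarrow> real \<Rightarrow> real \<Rightarrow> 'e sc_data \<Rightarrow> 'e set pmf \<Rightarrow> ('e set \<Rightarrow> 'e cost_vector) \<Rightarrow>
     'e solution \<Rightarrow> bool" where
  "near_optimal X \<epsilon> \<gamma> I P w s \<longleftrightarrow>
     is_solution X I s \<and> total_cost I P w s \<le> (1 + \<epsilon>) * OPT X I P w + \<gamma>"

text \<open>
  An adaptive randomized sampling procedure with observations \<open>'o\<close> and results \<open>'r\<close>: it stops with
  a result, or draws one sample from the black box, or draws internal (discrete) randomness that is
  not counted as a sample, and continues depending on the outcome.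
\<close>

datatype ('o, 'r) procedure =
    Return 'r
  | Sample "'o \<Rightarrow> ('o, 'r) procedure"
  | Toss "nat pmf" "nat \<Rightarrow> ('o, 'r) procedure"

primrec run :: "'o pmf \<Rightarrow> ('o, 'r) procedure \<Rightarrow> 'r pmf" where
  "run D (Return r) = return_pmf r"
| "run D (Sample k) = bind_pmf D (\<lambda>z. run D (k z))"
| "run D (Toss p k) = bind_pmf p (\<lambda>i. run D (k i))"

text \<open>With samples drawn from \<open>D\<close>, no run of the procedure draws more than \<open>n\<close> samples.\<close>

primrec draws_at_most :: "'o pmf \<Rightarrow> ('o, 'r) procedure \<Rightarrow> nat \<Rightarrow> bool" where
  "draws_at_most D (Return r) n \<longleftrightarrow> True"
| "draws_at_most D (Sample k) n \<longleftrightarrow> n > 0 \<and> (\<forall>z\<in>set_pmf D. draws_at_most D (k z) (n - 1))"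
| "draws_at_most D (Toss p k) n \<longleftrightarrow> (\<forall>i\<in>set_pmf p. draws_at_most D (k i) n)"

text \<open>A sample consists of a scenario together with its costs.\<close>

definition sampling_dist ::
    "'e set pmf \<Rightarrow> ('e set \<Rightarrow> 'e cost_vector) \<Rightarrow> ('e set \<times> 'e cost_vector) pmf" where
  "sampling_dist P w = map_pmf (\<lambda>A. (A, w A)) P"

text \<open>
  Costs of scenarios that were not sampled are unknown to the algorithm.  It therefore returns its
  second stage as a policy, which computes the decisions for a scenario from that scenario and its
  costs.
\<close>

type_synonym 'e strategy =
  "('e set \<Rightarrow> real) \<times> ('e set \<Rightarrow> 'e cost_vector \<Rightarrow> 'e set \<Rightarrow> real)"

definition realize :: "('e set \<Rightarrow> 'e cost_vector) \<Rightarrow> 'e strategy \<Rightarrow> 'e solution" where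
  "realize w = (\<lambda>(x, r). (x, \<lambda>A. r A (w A)))"

type_synonym 'e algorithm =
  "'e sc_data \<Rightarrow> ('e set \<times> 'e cost_vector, 'e strategy) procedure"

text \<open>The random solution returned by an algorithm.\<close>

definition returned_solution ::
    "'e algorithm \<Rightarrow> 'e sc_data \<Rightarrow> 'e set pmf \<Rightarrow> ('e set \<Rightarrow> 'e cost_vector) \<Rightarrow> 'e solution pmf" where
  "returned_solution alg I P w = map_pmf (realize w) (run (sampling_dist P w) (alg I))"

definition near_optimal_algorithm ::
    "real set \<Rightarrow> real \<Rightarrow> real \<Rightarrow> real \<Rightarrow> 'e algorithm \<Rightarrow> bool" where
  "near_optimal_algorithm X \<epsilon> \<gamma> \<delta> alg \<longleftrightarrow>
     (\<forall>I P w. valid_input I P w \<longrightarrow>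
        (\<exists>N. draws_at_most (sampling_dist P w) (alg I) N) \<and>
        measure_pmf.prob (returned_solution alg I P w) {s. near_optimal X \<epsilon> \<gamma> I P w s} \<ge> 1 - \<delta>)"

text \<open>
  On inputs with threshold \<open>\<rho>\<close>, the returned solution has second-stage cost exceeding the budget
  with probability at most \<open>\<tau> \<rho>\<close>, except with failure probability \<open>\<delta>\<close>.  Inputs with \<open>\<rho>\<close> outside \<open>R\<close> are exempt; this matters for multiplicative
  relaxations, which do not relax \<open>\<rho> = 0\<close> at all.
\<close>

definition respects_threshold ::
    "real set \<Rightarrow> (real \<Rightarrow> real) \<Rightarrow> real \<Rightarrow> 'e algorithm \<Rightarrow> bool" where
  "respects_threshold R \<tau> \<delta> alg \<longleftrightarrow>
     (\<forall>I P w. valid_input I P w \<and> threshold I \<in> R \<longrightarrow>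
        measure_pmf.prob (returned_solution alg I P w)
          {s. exceed_prob I P w s \<le> \<tau> (threshold I)} \<ge> 1 - \<delta>)"

text \<open>
  On some input with known part \<open>I\<close>, the worst-case number of samples drawn is at least \<open>b\<close>.
\<close>

definition requires_samples :: "'e algorithm \<Rightarrow> 'e sc_data \<Rightarrow> real \<Rightarrow> bool" where
  "requires_samples alg I b \<longleftrightarrow>
     (\<exists>P w. valid_input I P w \<and>
        (\<forall>N. draws_at_most (sampling_dist P w) (alg I) N \<longrightarrow> b \<le> real N))"

end

theory Submission
  imports Defs
begin

text \<open>
  One element \<open>e\<close>, one set \<open>{e}\<close>, budget 0, unit scenario costs, and a prohibitive first-stage cost.
  The scenario is \<open>{e}\<close> with probability \<open>p\<close> and empty otherwise.  If \<open>p = \<rho>\<close>, covering \<open>e\<close> in the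
  second stage is allowed and cheap, so every near-optimal solution leaves part of \<open>e\<close> uncovered
  in the first stage.  Such a solution exceeds the budget with probability exactly \<open>p\<close>, so for \<open>p\<close>
  slightly above the relaxed threshold it is forbidden.  The algorithm thus has to tell two coins
  of bias difference \<open>d\<close> apart, and the outcome distributions of \<open>n\<close> samples differ by at most \<open>n d\<close>
  in total variation.
\<close>

section \<open>Sampling procedures under two close distributions\<close>

lemma measure_bind_pmf_eq_expectation:
  "measure_pmf.prob (bind_pmf p f) A = measure_pmf.expectation p (\<lambda>x. measure_pmf.prob (f x) A)"
proof -
  have "emeasure (measure_pmf (bind_pmf p f)) A = (\<integral>\<^sup>+x. measure_pmf.prob (f x) A \<partial>p)"
    by (simp add: emeasure_bind_pmf flip: measure_pmf.emeasure_eq_measure)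
  also have "\<dots> = ennreal (measure_pmf.expectation p (\<lambda>x. measure_pmf.prob (f x) A))"
    by (intro nn_integral_eq_integral measure_pmf.integrable_const_bound[where B = 1]) auto
  finally show ?thesis
    by (simp add: measure_pmf.emeasure_eq_measure)
qed

lemma abs_expectation_diff_le:
  fixes f g :: "'a \<Rightarrow> real"
  assumes f: "\<And>x. 0 \<le> f x \<and> f x \<le> 1" and g: "\<And>x. 0 \<le> g x \<and> g x \<le> 1"
    and diff: "\<And>x. x \<in> set_pmf p \<Longrightarrow> \<bar>f x - g x\<bar> \<le> c"
  shows "\<bar>measure_pmf.expectation p f - measure_pmf.expectation p g\<bar> \<le> c"
proof -
  have [simp]: "integrable (measure_pmf p) f" "integrable (measure_pmf p) g"
    using f g by (auto intro!: measure_pmf.integrable_const_bound[where B = 1])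
  have "\<bar>measure_pmf.expectation p (\<lambda>x. f x - g x)\<bar> \<le> measure_pmf.expectation p (\<lambda>x. \<bar>f x - g x\<bar>)"
    by (rule integral_abs_bound)
  also have "\<dots> \<le> measure_pmf.expectation p (\<lambda>_. c)"
    using diff by (intro integral_mono_AE) (auto simp: AE_measure_pmf_iff)
  finally show ?thesis
    by simp
qed

text \<open>Hybrid argument: the distributions are exchanged one draw at a time, each exchange costs
  at most \<open>d\<close>, and tosses cost nothing because both runs share \<open>p\<close>.
  Closeness is phrased with [0,1]-valued test functions so that it applies directly to the success
  probability of the continuation. The draw bound is known under \<open>D'\<close> alone;
  \<open>supp\<close> carries it over to every outcome of \<open>D\<close>.\<close>

lemma run_total_variation:
  assumes tv: "\<And>f. (\<And>z. 0 \<le> f z \<and> f z \<le> 1) \<Longrightarrow>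
      \<bar>measure_pmf.expectation D f - measure_pmf.expectation D' f\<bar> \<le> d"
    and supp: "set_pmf D \<subseteq> set_pmf D'"
    and "draws_at_most D' k n"
  shows "\<bar>measure_pmf.prob (run D k) A - measure_pmf.prob (run D' k) A\<bar> \<le> real n * d"
  using assms(3)
proof (induction k arbitrary: n)
  case (Return r)
  \<comment> \<open>A procedure that stops at once may still come with a positive \<open>n\<close>,
    so the bound needs \<open>d\<close> to be nonnegative.\<close>
  have "0 \<le> d"
    using tv[of "\<lambda>_. 0"] by simp
  then show ?case
    by simp
next
  case (Sample k)
  define f where "f = (\<lambda>z. measure_pmf.prob (run D (k z)) A)"
  define g where "g = (\<lambda>z. measure_pmf.prob (run D' (k z)) A)"
  \<comment> \<open>The intermediate hybrid draws the first sample from \<open>D\<close> and all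
    later ones from \<open>D'\<close>; the induction hypothesis bounds its distance to the pure
    \<open>D\<close> run.\<close>
  have "\<bar>measure_pmf.expectation D f - measure_pmf.expectation D g\<bar> \<le> real (n - 1) * d"
  proof (rule abs_expectation_diff_le)
    fix z assume "z \<in> set_pmf D"
    then have "draws_at_most D' (k z) (n - 1)"
      using Sample.prems supp by auto
    then show "\<bar>f z - g z\<bar> \<le> real (n - 1) * d"
      unfolding f_def g_def by (rule Sample.IH[OF rangeI])
  qed (auto simp: f_def g_def)
  moreover have "\<bar>measure_pmf.expectation D g - measure_pmf.expectation D' g\<bar> \<le> d"
    by (rule tv) (auto simp: g_def)
  moreover have "real n * d = real (n - 1) * d + d"
    using Sample.prems by (simp add: of_nat_diff algebra_simps)
  ultimately show ?case
    by (simp add: measure_bind_pmf_eq_expectation f_def g_def)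
next
  case (Toss p k)
  then show ?case
    unfolding run.simps measure_bind_pmf_eq_expectation
    by (intro abs_expectation_diff_le) auto
qed

section \<open>The one-element instance and its near-optimal solutions\<close>

definition single_data :: "'e \<Rightarrow> real \<Rightarrow> real \<Rightarrow> 'e sc_data" where
  "single_data e M \<rho> = \<lparr>universe = {e}, family = {{e}}, first_cost = (\<lambda>_. M), budget = 0,
     threshold = \<rho>, cost_bound = 1\<rparr>"

definition coin_scenario :: "'e \<Rightarrow> real \<Rightarrow> 'e set pmf" where
  "coin_scenario e p = map_pmf (\<lambda>b. if b then {e} else {}) (bernoulli_pmf p)"

definition unit_costs :: "'e set \<Rightarrow> 'e cost_vector" where
  "unit_costs = (\<lambda>_ _. 1)"

lemma single_data_simps [simp]:
  "universe (single_data e M \<rho>) = {e}" "family (single_data e M \<rho>) = {{e}}"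
  "first_cost (single_data e M \<rho>) S = M" "budget (single_data e M \<rho>) = 0"
  "threshold (single_data e M \<rho>) = \<rho>" "cost_bound (single_data e M \<rho>) = 1"
  "single_data e M \<rho>\<lparr>threshold := \<rho>'\<rparr> = single_data e M \<rho>'"
  by (simp_all add: single_data_def)

lemma valid_single_input:
  "0 \<le> M \<Longrightarrow> 0 \<le> \<rho> \<Longrightarrow> \<rho> \<le> 1 \<Longrightarrow> valid_input (single_data e M \<rho>) (coin_scenario e p) unit_costs"
  by (auto simp: valid_input_def valid_data_def coin_scenario_def unit_costs_def)

lemma second_stage_cost_single:
  "second_stage_cost (single_data e M \<rho>) unit_costs s A = snd s A {e}"
  by (simp add: second_stage_cost_def unit_costs_def)

lemma total_cost_single:
  assumes "0 \<le> p" "p \<le> 1"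
  shows "total_cost (single_data e M \<rho>) (coin_scenario e p) unit_costs s =
    M * fst s {e} + p * snd s {e} {e} + (1 - p) * snd s {} {e}"
  using assms
  by (simp add: total_cost_def second_stage_cost_single[abs_def] coin_scenario_def)

text \<open>With budget 0 and unit costs, any positive second-stage decision, however small, exceeds
  the budget. Fractional solutions therefore gain nothing over integral ones here.\<close>

lemma exceed_prob_single:
  assumes "0 \<le> p" "p \<le> 1"
  shows "exceed_prob (single_data e M \<rho>) (coin_scenario e p) unit_costs s =
    (if snd s {e} {e} > 0 then p else 0) + (if snd s {} {e} > 0 then 1 - p else 0)"
proof -
  let ?E = "{b. snd s (if b then {e} else {}) {e} > 0}"
  have "exceed_prob (single_data e M \<rho>) (coin_scenario e p) unit_costs s =
      measure_pmf.prob (bernoulli_pmf p) ?E"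
    by (simp add: exceed_prob_def second_stage_cost_single coin_scenario_def vimage_def)
  also have "\<dots> = (\<Sum>b\<in>?E. pmf (bernoulli_pmf p) b)"
    by (rule measure_measure_pmf_finite) simp
  also have "\<dots> = (\<Sum>b\<in>UNIV. if b \<in> ?E then pmf (bernoulli_pmf p) b else 0)"
    by (simp add: sum.If_cases)
  finally show ?thesis
    using assms by (simp add: UNIV_bool)
qed

lemma is_solution_single:
  "is_solution Y (single_data e M \<rho>) s \<longleftrightarrow>
     fst s {e} \<in> Y \<and> snd s {} {e} \<in> Y \<and> snd s {e} {e} \<in> Y \<and> fst s {e} + snd s {e} {e} \<ge> 1"
proof -
  have "{S. S = {e} \<and> e \<in> S} = {{e}}" 
    by auto
  moreover have "(\<forall>A\<subseteq>{e}. Q A) \<longleftrightarrow> Q {} \<and> Q {e}" for Q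
    by (auto simp: subset_singleton_iff)
  ultimately show ?thesis
    by (auto simp: is_solution_def case_prod_unfold)
qed

lemma OPT_single_le:
  assumes X: "X = {0, 1} \<or> X = {0..1}" and "0 \<le> M" "0 \<le> \<rho>" "\<rho> \<le> 1"
  shows "OPT X (single_data e M \<rho>) (coin_scenario e \<rho>) unit_costs \<le> \<rho>"
  unfolding OPT_def
proof (rule cInf_lower)
  \<comment> \<open>Buy nothing in advance and cover \<open>e\<close> only when it occurs: both the
    cost and the probability of exceeding the budget equal \<rho>.\<close>
  define s :: "'a solution" where "s = (\<lambda>_. 0, \<lambda>A _. if A = {} then 0 else 1)"
  have "is_solution X (single_data e M \<rho>) s"
    using X by (auto simp: is_solution_single s_def)
  moreover have "exceed_prob (single_data e M \<rho>) (coin_scenario e \<rho>) unit_costs s \<le> \<rho>"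
    "total_cost (single_data e M \<rho>) (coin_scenario e \<rho>) unit_costs s = \<rho>"
    using assms by (simp_all add: exceed_prob_single total_cost_single s_def)
  ultimately show "\<rho> \<in> {total_cost (single_data e M \<rho>) (coin_scenario e \<rho>) unit_costs s | s.
      is_solution X (single_data e M \<rho>) s \<and>
      exceed_prob (single_data e M \<rho>) (coin_scenario e \<rho>) unit_costs s
        \<le> threshold (single_data e M \<rho>)}"
    by (intro CollectI exI[of _ s]) simp
  \<comment> \<open>Nonnegative costs bound the set from below, without which a member would not
    bound the real-valued \<open>Inf\<close>.\<close>
  have "0 \<le> total_cost (single_data e M \<rho>) (coin_scenario e \<rho>) unit_costs s"
    if "is_solution X (single_data e M \<rho>) s" for s
    using that X assms(2-) by (auto simp: is_solution_single total_cost_single)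
  then show "bdd_below {total_cost (single_data e M \<rho>) (coin_scenario e \<rho>) unit_costs s | s.
      is_solution X (single_data e M \<rho>) s \<and>
      exceed_prob (single_data e M \<rho>) (coin_scenario e \<rho>) unit_costs s
        \<le> threshold (single_data e M \<rho>)}"
    by (auto intro!: bdd_belowI[of _ 0])
qed

text \<open>Since \<open>OPT\<close> is at most \<rho> \<le> 1, a near-optimal cost is at most 1 +
  \<epsilon> + \<gamma>, which is \<open>M\<close> - 1. The first stage then takes less than a full
  copy of \<open>{e}\<close>, and the covering constraint forces the rest into the second
  stage.\<close>

lemma near_optimal_single_uses_second_stage:
  assumes X: "X = {0, 1} \<or> X = {0..1}" and "\<epsilon> > 0" "\<gamma> > 0" "0 \<le> \<rho>" "\<rho> \<le> 1"
    and M: "M = 2 + \<epsilon> + \<gamma>"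
    and "near_optimal X \<epsilon> \<gamma> (single_data e M \<rho>) (coin_scenario e \<rho>) unit_costs s"
  shows "is_solution X (single_data e M \<rho>) s \<and> snd s {e} {e} > 0"
proof -
  let ?I = "single_data e M \<rho>" and ?P = "coin_scenario e \<rho>"
  have sol: "is_solution X ?I s"
    and cost: "total_cost ?I ?P unit_costs s \<le> (1 + \<epsilon>) * OPT X ?I ?P unit_costs + \<gamma>"
    using assms(7) by (auto simp: near_optimal_def)
  have "M * fst s {e} \<le> total_cost ?I ?P unit_costs s"
    using sol X assms(4,5) by (auto simp: total_cost_single is_solution_single)
  also note cost
  also have "(1 + \<epsilon>) * OPT X ?I ?P unit_costs \<le> (1 + \<epsilon>) * 1"
    using OPT_single_le[OF X _ assms(4,5), of M e] assms by (intro mult_left_mono) auto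
  finally have "M * fst s {e} < M * 1"
    using M by simp
  then have "fst s {e} < 1"
    using M assms(2,3) by (subst (asm) mult_less_cancel_left_pos) auto
  then show ?thesis
    using sol by (auto simp: is_solution_single)
qed

section \<open>Distinguishing two coins by sampling\<close>

lemma coin_scenario_total_variation:
  fixes f :: "'e set \<times> 'e cost_vector \<Rightarrow> real"
  assumes "0 \<le> p" "p \<le> 1" "0 \<le> q" "q \<le> 1" and f: "\<And>z. 0 \<le> f z \<and> f z \<le> 1"
  shows "\<bar>measure_pmf.expectation (sampling_dist (coin_scenario e p) w) f -
      measure_pmf.expectation (sampling_dist (coin_scenario e q) w) f\<bar> \<le> \<bar>p - q\<bar>"
proof -
  define a b where "a = f ({e}, w {e})" and "b = f ({}, w {})"
  \<comment> \<open>The expectation is affine in the bias with slope \<open>a - b\<close>, and this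
    slope is at most 1 in absolute value.\<close>
  have *: "measure_pmf.expectation (sampling_dist (coin_scenario e p) w) f = p * a + (1 - p) * b"
    if "0 \<le> p" "p \<le> 1" for p
    using that by (simp add: sampling_dist_def coin_scenario_def a_def b_def)
  have "\<bar>a - b\<bar> \<le> 1"
    using f[of "({e}, w {e})"] f[of "({}, w {})"] by (auto simp: a_def b_def)
  then have "\<bar>p - q\<bar> * \<bar>a - b\<bar> \<le> \<bar>p - q\<bar> * 1"
    by (intro mult_left_mono) auto
  moreover have "(p * a + (1 - p) * b) - (q * a + (1 - q) * b) = (p - q) * (a - b)"
    by (simp add: algebra_simps)
  ultimately show ?thesis
    using assms by (simp add: * abs_mult)
qed

lemma set_pmf_coin_scenario_subset:
  "set_pmf (coin_scenario e p) \<subseteq> {{}, {e}}"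
  by (auto simp: coin_scenario_def)

lemma set_pmf_coin_scenario:
  "0 < p \<Longrightarrow> p < 1 \<Longrightarrow> set_pmf (coin_scenario e p) = {{}, {e}}"
  by (auto simp: coin_scenario_def set_pmf_bernoulli)

lemma set_pmf_sampling_coin:
  "0 < q \<Longrightarrow> q < 1 \<Longrightarrow>
     set_pmf (sampling_dist (coin_scenario e p) w) \<subseteq> set_pmf (sampling_dist (coin_scenario e q) w)"
  using set_pmf_coin_scenario_subset[of e p] by (auto simp: sampling_dist_def set_pmf_coin_scenario)

text \<open>The number of samples is measured on the input with bias \<open>q\<close>, whose support is full even if \<open>\<rho> = 0\<close>.\<close>

lemma coin_sample_lower_bound:
  assumes X: "X = {0, 1} \<or> X = {0..1}" and "\<epsilon> > 0" "\<gamma> > 0" "0 \<le> \<rho>" "\<rho> < q" "q < 1"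
    and M: "M = 2 + \<epsilon> + \<gamma>"
    and alg: "near_optimal_algorithm X \<epsilon> \<gamma> \<delta> alg"
    and bad: "measure_pmf.prob
        (returned_solution alg (single_data e M \<rho>) (coin_scenario e q) unit_costs)
        {s. is_solution X (single_data e M \<rho>) s \<and>
            exceed_prob (single_data e M \<rho>) (coin_scenario e q) unit_costs s \<ge> q} \<le> \<delta>"
    and draws: "draws_at_most (sampling_dist (coin_scenario e q) unit_costs)
        (alg (single_data e M \<rho>)) n"
  shows "1 - 2 * \<delta> \<le> real n * (q - \<rho>)"
proof -
  let ?I = "single_data e M \<rho>"
  \<comment> \<open>\<open>E\<close> does not mention the bias, so one and the same event can be
    measured under both coins: it is likely at bias \<rho> and unlikely at bias
    \<open>q\<close>.\<close>
  define E where "E = {s. is_solution X ?I s \<and> snd s {e} {e} > 0}"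
  let ?R = "\<lambda>p. run (sampling_dist (coin_scenario e p) unit_costs) (alg ?I)"
  let ?E = "realize unit_costs -` E"
  have "1 - \<delta> \<le> measure_pmf.prob (returned_solution alg ?I (coin_scenario e \<rho>) unit_costs)
      {s. near_optimal X \<epsilon> \<gamma> ?I (coin_scenario e \<rho>) unit_costs s}"
    using alg valid_single_input[of M \<rho> e \<rho>] assms unfolding near_optimal_algorithm_def by simp
  also have "\<dots> \<le> measure_pmf.prob (returned_solution alg ?I (coin_scenario e \<rho>) unit_costs) E"
    using near_optimal_single_uses_second_stage[OF X \<open>\<epsilon> > 0\<close> \<open>\<gamma> > 0\<close> \<open>0 \<le> \<rho>\<close> _ M, of e] assms
    by (intro measure_pmf.finite_measure_mono) (auto simp: E_def)
  finally have lower: "1 - \<delta> \<le> measure_pmf.prob (?R \<rho>) ?E"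
    by (simp add: returned_solution_def)
  \<comment> \<open>At bias \<open>q\<close> every solution in \<open>E\<close> exceeds the budget
    with probability at least \<open>q\<close>, so \<open>E\<close> lies inside the event bounded by
    \<open>bad\<close>.\<close>
  have "measure_pmf.prob (returned_solution alg ?I (coin_scenario e q) unit_costs) E \<le> \<delta>"
    using assms
    by (intro order.trans[OF measure_pmf.finite_measure_mono bad])
       (auto simp: E_def exceed_prob_single)
  then have "measure_pmf.prob (?R q) ?E \<le> \<delta>"
    by (simp add: returned_solution_def)
  moreover have "\<bar>measure_pmf.prob (?R \<rho>) ?E - measure_pmf.prob (?R q) ?E\<bar> \<le> real n * \<bar>\<rho> - q\<bar>"
    using assms by (intro run_total_variation[OF _ _ draws] coin_scenario_total_variation
      set_pmf_sampling_coin) simp_all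
  ultimately show ?thesis
    using lower \<open>\<rho> < q\<close> by simp
qed

section \<open>The three lower bounds\<close>

lemma draws_at_most_cong_support:
  "set_pmf D = set_pmf D' \<Longrightarrow> draws_at_most D k n = draws_at_most D' k n"
  by (induction k arbitrary: n) auto

text \<open>The sample bound \<open>n\<close> is fixed at bias 1/2 before the second coin is chosen.
  That coin can then be taken so close that \<open>n\<close> samples cannot separate the
  two.\<close>

lemma near_optimal_algorithm_violates_threshold:
  fixes alg :: "'e algorithm"
  assumes X: "X = {0, 1} \<or> X = {0..1}" and pos: "\<epsilon> > 0" "\<gamma> > 0" and "\<delta> < 1 / 2"
    and alg: "near_optimal_algorithm X \<epsilon> \<gamma> \<delta> alg"
  shows "\<exists>I P w. valid_input I P w \<and>
    measure_pmf.prob (returned_solution alg I P w)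
      {s. is_solution X I s \<and> exceed_prob I P w s > threshold I} > \<delta>"
proof (rule ccontr)
  fix e :: 'e
  define M where "M = 2 + \<epsilon> + \<gamma>"
  assume contr: "\<not> ?thesis"
  let ?I = "single_data e M (1 / 2)"
  have valid: "valid_input ?I (coin_scenario e p) unit_costs" for p
    using pos by (intro valid_single_input) (auto simp: M_def)
  obtain n where n: "draws_at_most (sampling_dist (coin_scenario e (1 / 2)) unit_costs) (alg ?I) n"
    using alg valid unfolding near_optimal_algorithm_def by blast
  \<comment> \<open>The first term keeps \<open>q\<close> below 1; the second makes
    \<open>real n * d\<close> smaller than 1 - 2\<delta>, contradicting the coin bound.\<close>
  define d where "d = min (1 / 4) ((1 - 2 * \<delta>) / (real n + 1))"
  have d: "0 < d" "d \<le> 1 / 4" "d \<le> (1 - 2 * \<delta>) / (real n + 1)"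
    using \<open>\<delta> < 1 / 2\<close> by (auto simp: d_def)
  define q where "q = 1 / 2 + d"
  \<comment> \<open>Both biases lie strictly between 0 and 1, so the supports agree and
    \<open>n\<close> also bounds the draws at bias \<open>q\<close>.\<close>
  have "set_pmf (sampling_dist (coin_scenario e (1 / 2)) unit_costs) =
      set_pmf (sampling_dist (coin_scenario e q) unit_costs)"
    using d by (intro equalityI set_pmf_sampling_coin) (auto simp: q_def)
  then have draws: "draws_at_most (sampling_dist (coin_scenario e q) unit_costs) (alg ?I) n"
    using n draws_at_most_cong_support by blast
  let ?R = "returned_solution alg ?I (coin_scenario e q) unit_costs"
  have "measure_pmf.prob ?R {s. is_solution X ?I s \<and>
        exceed_prob ?I (coin_scenario e q) unit_costs s \<ge> q} \<le>
      measure_pmf.prob ?R {s. is_solution X ?I s \<and>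
        exceed_prob ?I (coin_scenario e q) unit_costs s > threshold ?I}"
    using d by (intro measure_pmf.finite_measure_mono) (auto simp: q_def)
  also have "\<dots> \<le> \<delta>"
    using contr valid by (meson not_less)
  finally have "1 - 2 * \<delta> \<le> real n * (q - 1 / 2)"
    using d by (intro coin_sample_lower_bound[OF X pos _ _ _ M_def alg _ draws]) (auto simp: q_def)
  moreover have "d * (real n + 1) \<le> 1 - 2 * \<delta>"
    using d(3) by (simp add: pos_le_divide_eq)
  ultimately show False
    using d(1) by (simp add: q_def algebra_simps)
qed

text \<open>Treats both relaxations at once through the slack \<eta> that \<tau> adds at \<rho>: it
  is \<open>\<kappa>\<close> in the additive case and \<open>\<kappa> * \<rho>\<close> in the
  multiplicative one.\<close>

lemma relaxed_threshold_requires_samples: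
  fixes alg :: "'e algorithm"
  assumes X: "X = {0, 1} \<or> X = {0..1}" and pos: "\<epsilon> > 0" "\<gamma> > 0"
    and \<eta>: "\<eta> > 0" "0 \<le> \<rho>" "\<rho> + \<eta> < 1" "\<rho> \<in> R" "\<tau> \<rho> = \<rho> + \<eta>"
    and alg: "near_optimal_algorithm X \<epsilon> \<gamma> \<delta> alg"
    and resp: "respects_threshold R \<tau> \<delta> alg"
  shows "requires_samples alg (single_data e (2 + \<epsilon> + \<gamma>) \<rho>) ((1 - 2 * \<delta>) / 2 / \<eta>)"
proof -
  define M where "M = 2 + \<epsilon> + \<gamma>"
  \<comment> \<open>The bias must lie strictly above the relaxed threshold, below 1, and within
    2\<eta> of \<rho>; the last requirement is the source of the factor 1/2 in the constant.\<close>
  define q where "q = \<rho> + \<eta> + min \<eta> ((1 - \<rho> - \<eta>) / 2)"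
  have q: "\<rho> + \<eta> < q" "q < 1" "q \<le> \<rho> + 2 * \<eta>"
    using \<eta> by (auto simp: q_def min_def field_simps)
  let ?I = "single_data e M \<rho>"
  let ?R = "returned_solution alg ?I (coin_scenario e q) unit_costs"
  have valid: "valid_input ?I (coin_scenario e q) unit_costs"
    using pos \<eta> by (intro valid_single_input) (auto simp: M_def)
  let ?ok = "{s. exceed_prob ?I (coin_scenario e q) unit_costs s \<le> \<tau> \<rho>}"
  have "1 - \<delta> \<le> measure_pmf.prob ?R ?ok"
    using resp valid \<open>\<rho> \<in> R\<close> unfolding respects_threshold_def
    by (metis single_data_simps(5))
  then have "measure_pmf.prob ?R (- ?ok) \<le> \<delta>"
    using measure_pmf.prob_compl[of ?ok ?R] by (simp add: Compl_eq_Diff_UNIV)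
  \<comment> \<open>Exceeding with probability at least \<open>q\<close> >
    \<open>\<tau> \<rho>\<close> already breaks the relaxed threshold.\<close>
  then have bad: "measure_pmf.prob ?R {s. is_solution X ?I s \<and>
      exceed_prob ?I (coin_scenario e q) unit_costs s \<ge> q} \<le> \<delta>"
    using q \<eta> by (elim order.trans[rotated]) (intro measure_pmf.finite_measure_mono, auto)
  have "(1 - 2 * \<delta>) / 2 / \<eta> \<le> real n"
    if "draws_at_most (sampling_dist (coin_scenario e q) unit_costs) (alg ?I) n" for n
  proof -
    have "1 - 2 * \<delta> \<le> real n * (q - \<rho>)"
      using q \<eta> by (intro coin_sample_lower_bound[OF X pos _ _ _ M_def alg bad that]) auto
    also have "\<dots> \<le> real n * (2 * \<eta>)"
      using q by (intro mult_left_mono) auto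
    finally show ?thesis
      using \<eta> by (simp add: field_simps)
  qed
  then show ?thesis
    using valid unfolding requires_samples_def M_def by blast
qed

theorem theorem8:
  fixes \<epsilon> \<gamma> \<delta> :: real and X :: "real set"
  assumes "\<epsilon> > 0" and "\<gamma> > 0" and "\<delta> < 1 / 2"
    and "X = {0, 1} \<or> X = {0..1}"
  shows
    "(\<forall>alg :: 'e algorithm. near_optimal_algorithm X \<epsilon> \<gamma> \<delta> alg \<longrightarrow>
        (\<exists>I P w. valid_input I P w \<and>
           measure_pmf.prob (returned_solution alg I P w)
             {s. is_solution X I s \<and> exceed_prob I P w s > threshold I} > \<delta>))
     \<and>
     (\<exists>c>0. \<exists>I :: 'e sc_data. \<forall>\<kappa> \<rho>. \<forall>alg :: 'e algorithm.
        \<kappa> > 0 \<and> 0 \<le> \<rho> \<and> \<rho> + \<kappa> < 1 \<and>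
        near_optimal_algorithm X \<epsilon> \<gamma> \<delta> alg \<and>
        respects_threshold {0..1} (\<lambda>r. r + \<kappa>) \<delta> alg \<longrightarrow>
        requires_samples alg (I\<lparr>threshold := \<rho>\<rparr>) (c / \<kappa>))
     \<and>
     (\<exists>c>0. \<exists>I :: 'e sc_data. \<forall>\<kappa> \<rho>. \<forall>alg :: 'e algorithm.
        \<kappa> > 0 \<and> 0 < \<rho> \<and> \<rho> * (1 + \<kappa>) < 1 \<and>
        near_optimal_algorithm X \<epsilon> \<gamma> \<delta> alg \<and>
        respects_threshold {0<..1} (\<lambda>r. r * (1 + \<kappa>)) \<delta> alg \<longrightarrow>
        requires_samples alg (I\<lparr>threshold := \<rho>\<rparr>) (c / (\<kappa> * \<rho>)))"
proof (intro conjI allI impI)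
  fix alg :: "'e algorithm"
  assume "near_optimal_algorithm X \<epsilon> \<gamma> \<delta> alg"
  then show "\<exists>I P w. valid_input I P w \<and>
      measure_pmf.prob (returned_solution alg I P w)
        {s. is_solution X I s \<and> exceed_prob I P w s > threshold I} > \<delta>"
    using assms by (intro near_optimal_algorithm_violates_threshold)
next
  fix e :: 'e
  \<comment> \<open>The threshold 0 is a placeholder overwritten by the record update, so a single
    instance serves all \<kappa>, \<rho> and algorithms.\<close>
  let ?I = "single_data e (2 + \<epsilon> + \<gamma>) 0" and ?c = "(1 - 2 * \<delta>) / 2"
  have c: "?c > 0"
    using assms by simp
  have "requires_samples alg (?I\<lparr>threshold := \<rho>\<rparr>) (?c / \<kappa>)"
    if "\<kappa> > 0 \<and> 0 \<le> \<rho> \<and> \<rho> + \<kappa> < 1 \<and> near_optimal_algorithm X \<epsilon> \<gamma> \<delta> alg \<and>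
      respects_threshold {0..1} (\<lambda>r. r + \<kappa>) \<delta> alg" for \<kappa> \<rho> and alg :: "'e algorithm"
    unfolding single_data_simps using that assms
    by (intro relaxed_threshold_requires_samples
        [where X = X and R = "{0..1}" and \<tau> = "\<lambda>r. r + \<kappa>"]) auto
  with c show "\<exists>c>0. \<exists>I :: 'e sc_data. \<forall>\<kappa> \<rho>. \<forall>alg :: 'e algorithm.
      \<kappa> > 0 \<and> 0 \<le> \<rho> \<and> \<rho> + \<kappa> < 1 \<and> near_optimal_algorithm X \<epsilon> \<gamma> \<delta> alg \<and>
      respects_threshold {0..1} (\<lambda>r. r + \<kappa>) \<delta> alg \<longrightarrow>
      requires_samples alg (I\<lparr>threshold := \<rho>\<rparr>) (c / \<kappa>)"
    by blast
  \<comment> \<open>The multiplicative relaxation \<rho>(1 + \<kappa>) is an additive slack of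
    \<kappa>\<rho>, positive because \<rho> > 0.\<close>
  have "requires_samples alg (?I\<lparr>threshold := \<rho>\<rparr>) (?c / (\<kappa> * \<rho>))"
    if "\<kappa> > 0 \<and> 0 < \<rho> \<and> \<rho> * (1 + \<kappa>) < 1 \<and> near_optimal_algorithm X \<epsilon> \<gamma> \<delta> alg \<and>
      respects_threshold {0<..1} (\<lambda>r. r * (1 + \<kappa>)) \<delta> alg" for \<kappa> \<rho> and alg :: "'e algorithm"
  proof -
    have pos: "0 < \<kappa> * \<rho>"
      using that by simp
    moreover have sum: "\<rho> + \<kappa> * \<rho> < 1"
      using that by (simp add: algebra_simps)
    moreover have "\<rho> \<le> 1"
      using pos sum by linarith
    ultimately show ?thesis
      unfolding single_data_simps using that assms
      by (intro relaxed_threshold_requires_samples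
          [where X = X and R = "{0<..1}" and \<tau> = "\<lambda>r. r * (1 + \<kappa>)"]) (auto simp: algebra_simps)
  qed
  with c show "\<exists>c>0. \<exists>I :: 'e sc_data. \<forall>\<kappa> \<rho>. \<forall>alg :: 'e algorithm.
      \<kappa> > 0 \<and> 0 < \<rho> \<and> \<rho> * (1 + \<kappa>) < 1 \<and> near_optimal_algorithm X \<epsilon> \<gamma> \<delta> alg \<and>
      respects_threshold {0<..1} (\<lambda>r. r * (1 + \<kappa>)) \<delta> alg \<longrightarrow>
      requires_samples alg (I\<lparr>threshold := \<rho>\<rparr>) (c / (\<kappa> * \<rho>))"
    by blast
qed

end
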